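(* Let $Z$ be a finite-dimensional operator space and let $Y$ be a separable (closed linear) subspace of $\ell^\infty(Z)$ containing $c_0(Z)$. Then $c_0(Z)$ is completely contractively cocomplemented in $Y$.
   Context: $\ell^\infty(Z)$ is the operator space of all bounded sequences in $Z$ with the sup norm and matrix norms given by suprema over coordinates, and $c_0(Z)$ is its subspace of sequences $(z_j)$ with $\|z_j\|\to0$. A closed subspace $X$ of an operator space $Y$ is completely contractively cocomplemented in $Y$ if there is a linear projection $P$ from $Y$ onto $X$ with $\|I-P\|_{cb}\le1$. *)

theory Defs
  imports "HOL-Analysis.Analysis" "HOL-Library.Function_Algebras"
begin

section \<open>Operator spaces\<close>

text \<open>
  An operator space is given in matricially normed form: a complex vector space \<open>carr E\<close> (a linear
  subspace of an ambient type) with a norm \<open>mnorm E n\<close> on \<open>M\<^sub>n (carr E)\<close> for every \<open>n\<close>, subject to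
  Ruan's axioms. An \<open>n\<close> by \<open>n\<close> matrix is a function \<open>nat \<Rightarrow> nat \<Rightarrow> 'a\<close> of which only the entries
  with both indices below \<open>n\<close> matter. The degenerate size \<open>n = 0\<close> is allowed; there all norms are 0.
\<close>

record 'a opspace =
  carr :: "'a set"
  scal :: "complex \<Rightarrow> 'a \<Rightarrow> 'a"
  mnorm :: "nat \<Rightarrow> (nat \<Rightarrow> nat \<Rightarrow> 'a) \<Rightarrow> real"

definition mats :: "nat \<Rightarrow> 'a set \<Rightarrow> (nat \<Rightarrow> nat \<Rightarrow> 'a) set" where
  "mats n V = {x. \<forall>i<n. \<forall>j<n. x i j \<in> V}"

text \<open>The norm of a scalar \<open>m\<close> by \<open>n\<close> matrix as an operator between Euclidean (Hilbert) spaces.\<close>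

definition scalar_mat_norm :: "nat \<Rightarrow> nat \<Rightarrow> (nat \<Rightarrow> nat \<Rightarrow> complex) \<Rightarrow> real" where
  "scalar_mat_norm m n a =
     (SUP v \<in> {v. (\<Sum>j<n. (cmod (v j))\<^sup>2) \<le> 1}. sqrt (\<Sum>i<m. (cmod (\<Sum>j<n. a i j * v j))\<^sup>2))"

text \<open>The matrix product \<open>a x b\<close>, with \<open>x\<close> of size \<open>n\<close> by \<open>n\<close>.\<close>

definition mat_compress ::
    "('a::ab_group_add) opspace \<Rightarrow> nat \<Rightarrow> (nat \<Rightarrow> nat \<Rightarrow> complex) \<Rightarrow> (nat \<Rightarrow> nat \<Rightarrow> 'a)
       \<Rightarrow> (nat \<Rightarrow> nat \<Rightarrow> complex) \<Rightarrow> nat \<Rightarrow> nat \<Rightarrow> 'a" where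
  "mat_compress E n a x b = (\<lambda>i j. \<Sum>k<n. \<Sum>l<n. scal E (a i k * b l j) (x k l))"

definition mat_dsum ::
    "nat \<Rightarrow> (nat \<Rightarrow> nat \<Rightarrow> 'a::zero) \<Rightarrow> (nat \<Rightarrow> nat \<Rightarrow> 'a) \<Rightarrow> nat \<Rightarrow> nat \<Rightarrow> 'a" where
  "mat_dsum m x y = (\<lambda>i j. if i < m \<and> j < m then x i j
                           else if m \<le> i \<and> m \<le> j then y (i - m) (j - m) else 0)"

locale operator_space = vector_space "scal E" for E :: "('a::ab_group_add) opspace" +
  assumes subspace_carr: "subspace (carr E)"
    and mnorm_cong: "\<And>n x y. (\<And>i j. i < n \<Longrightarrow> j < n \<Longrightarrow> x i j = y i j) \<Longrightarrow> mnorm E n x = mnorm E n y"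
    and mnorm_eq_0: "\<And>n x. x \<in> mats n (carr E) \<Longrightarrow> mnorm E n x = 0 \<longleftrightarrow> (\<forall>i<n. \<forall>j<n. x i j = 0)"
    and mnorm_triangle: "\<And>n x y. x \<in> mats n (carr E) \<Longrightarrow> y \<in> mats n (carr E) \<Longrightarrow>
          mnorm E n (\<lambda>i j. x i j + y i j) \<le> mnorm E n x + mnorm E n y"
    and mnorm_scal: "\<And>n x c. x \<in> mats n (carr E) \<Longrightarrow>
          mnorm E n (\<lambda>i j. scal E c (x i j)) = cmod c * mnorm E n x"
    and mnorm_dsum: "\<And>m n x y. x \<in> mats m (carr E) \<Longrightarrow> y \<in> mats n (carr E) \<Longrightarrow>
          mnorm E (m + n) (mat_dsum m x y) = max (mnorm E m x) (mnorm E n y)"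
    and mnorm_compress: "\<And>m n a x b. x \<in> mats n (carr E) \<Longrightarrow>
          mnorm E m (mat_compress E n a x b)
            \<le> scalar_mat_norm m n a * mnorm E n x * scalar_mat_norm n m b"

definition vnorm :: "'a opspace \<Rightarrow> 'a \<Rightarrow> real" where
  "vnorm E z = mnorm E 1 (\<lambda>_ _. z)"

text \<open>The case distinction makes this nonnegative and symmetric on the whole type, as
  \<^locale>\<open>Metric_space\<close> requires.\<close>

definition vdist :: "('a::ab_group_add) opspace \<Rightarrow> 'a \<Rightarrow> 'a \<Rightarrow> real" where
  "vdist E x y = (if x \<in> carr E \<and> y \<in> carr E then vnorm E (x - y) else 0)"

definition norm_topology :: "('a::ab_group_add) opspace \<Rightarrow> 'a topology" where
  "norm_topology E = Metric_space.mtopology (carr E) (vdist E)"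

definition finite_dimensional :: "('a::ab_group_add) opspace \<Rightarrow> bool" where
  "finite_dimensional E \<longleftrightarrow> (\<exists>B. finite B \<and> module.span (scal E) B = carr E)"

text \<open>The linear subspace \<open>X\<close> with the inherited matrix norms.\<close>

definition induced :: "'a opspace \<Rightarrow> 'a set \<Rightarrow> 'a opspace" where
  "induced E X = E\<lparr>carr := X\<rparr>"

definition closed_linear_subspace :: "('a::ab_group_add) set \<Rightarrow> 'a opspace \<Rightarrow> bool" where
  "closed_linear_subspace X E \<longleftrightarrow>
     module.subspace (scal E) X \<and> X \<subseteq> carr E \<and> closedin (norm_topology E) X"

definition linear_map ::
    "('a::ab_group_add) opspace \<Rightarrow> ('b::ab_group_add) opspace \<Rightarrow> ('a \<Rightarrow> 'b) \<Rightarrow> bool" where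
  "linear_map E F T \<longleftrightarrow>
     T ` carr E \<subseteq> carr F \<and>
     (\<forall>x\<in>carr E. \<forall>y\<in>carr E. T (x + y) = T x + T y) \<and>
     (\<forall>c. \<forall>x\<in>carr E. T (scal E c x) = scal F c (T x))"

text \<open>The completely bounded norm is extended-real valued, so that it is \<open>\<infinity>\<close> (and not a junk value)
  for maps that are not completely bounded.\<close>

definition cb_norm :: "'a opspace \<Rightarrow> 'b opspace \<Rightarrow> ('a \<Rightarrow> 'b) \<Rightarrow> ereal" where
  "cb_norm E F T =
     (SUP n. SUP x \<in> {x \<in> mats n (carr E). mnorm E n x \<le> 1}. ereal (mnorm F n (\<lambda>i j. T (x i j))))"

definition completely_contractively_cocomplemented ::
    "('a::ab_group_add) set \<Rightarrow> 'a opspace \<Rightarrow> bool" where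
  "completely_contractively_cocomplemented X E \<longleftrightarrow>
     closed_linear_subspace X E \<and>
     (\<exists>P. linear_map E E P \<and> P ` carr E = X \<and> (\<forall>x\<in>carr E. P (P x) = P x) \<and>
          cb_norm E E (\<lambda>x. x - P x) \<le> 1)"


section \<open>Bounded sequences and null sequences\<close>

definition linf :: "'a opspace \<Rightarrow> (nat \<Rightarrow> 'a) opspace" where
  "linf Z = \<lparr>carr = {f. (\<forall>k. f k \<in> carr Z) \<and> bdd_above (range (\<lambda>k. vnorm Z (f k)))},
             scal = (\<lambda>c f k. scal Z c (f k)),
             mnorm = (\<lambda>n x. SUP k. mnorm Z n (\<lambda>i j. x i j k))\<rparr>"

definition c0 :: "'a opspace \<Rightarrow> (nat \<Rightarrow> 'a) set" where
  "c0 Z = {f \<in> carr (linf Z). (\<lambda>k. vnorm Z (f k)) \<longlonglongrightarrow> 0}"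


section \<open>Well-definedness\<close>

lemma (in operator_space) Metric_space_vdist: "Metric_space (carr E) (vdist E)"
proof
  have m: "(\<lambda>_ _. z) \<in> mats 1 (carr E)" if "z \<in> carr E" for z
    using that by (simp add: mats_def)
  have zero: "vnorm E z = 0 \<longleftrightarrow> z = 0" if "z \<in> carr E" for z
    using mnorm_eq_0[OF m[OF that]] by (simp add: vnorm_def)
  have tri: "vnorm E (z + w) \<le> vnorm E z + vnorm E w" if "z \<in> carr E" "w \<in> carr E" for z w
    using mnorm_triangle[OF m m, OF that] by (simp add: vnorm_def)
  have minus: "vnorm E (- z) = vnorm E z" if "z \<in> carr E" for z
    using mnorm_scal[OF m[OF that], of "-1"] by (simp add: vnorm_def del: One_nat_def)
  have nonneg: "0 \<le> vnorm E z" if "z \<in> carr E" for z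
  proof -
    have "vnorm E (z + - z) \<le> vnorm E z + vnorm E (- z)"
      using that by (intro tri subspace_neg[OF subspace_carr])
    moreover have "vnorm E 0 = 0" using zero subspace_0[OF subspace_carr] by blast
    ultimately show ?thesis unfolding minus[OF that] by simp
  qed
  have diff: "x - y \<in> carr E" if "x \<in> carr E" "y \<in> carr E" for x y
    using subspace_diff[OF subspace_carr that] .
  show "0 \<le> vdist E x y" for x y
    unfolding vdist_def using nonneg[OF diff, of x y] by auto
  show "vdist E x y = vdist E y x" for x y
  proof (cases "x \<in> carr E \<and> y \<in> carr E")
    case True
    then have "vnorm E (- (x - y)) = vnorm E (x - y)" by (intro minus diff) auto
    with True show ?thesis unfolding vdist_def minus_diff_eq by metis
  qed (auto simp: vdist_def)
  show "vdist E x y = 0 \<longleftrightarrow> x = y" if "x \<in> carr E" "y \<in> carr E" for x y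
    using zero[OF diff[OF that]] that by (simp add: vdist_def)
  show "vdist E x z \<le> vdist E x y + vdist E y z"
    if "x \<in> carr E" "y \<in> carr E" "z \<in> carr E" for x y z
  proof -
    have "vnorm E ((x - y) + (y - z)) \<le> vnorm E (x - y) + vnorm E (y - z)"
      using that by (intro tri diff)
    then show ?thesis using that by (simp add: vdist_def)
  qed
qed

lemma (in operator_space) operator_space_induced:
  assumes "subspace X" "X \<subseteq> carr E"
  shows "operator_space (induced E X)"
proof -
  have *: "x \<in> mats n X \<Longrightarrow> x \<in> mats n (carr E)" for x n
    using assms(2) by (auto simp: mats_def)
  have c: "mat_compress (induced E X) = mat_compress E"
    by (intro ext) (simp add: mat_compress_def induced_def)
  have s: "scal (induced E X) = scal E" "carr (induced E X) = X" "mnorm (induced E X) = mnorm E"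
    by (simp_all add: induced_def)
  show ?thesis
    by (intro operator_space.intro operator_space_axioms.intro; unfold c s)
      (fact vector_space_axioms assms(1) | (rule mnorm_cong, assumption)
        | (intro mnorm_eq_0 mnorm_triangle mnorm_scal mnorm_dsum mnorm_compress *, assumption+))+
qed

lemma (in operator_space) mnorm_zero: "mnorm E n (\<lambda>_ _. 0) = 0"
  using mnorm_eq_0[of "\<lambda>_ _. 0" n] subspace_0[OF subspace_carr] by (simp add: mats_def)

lemma (in operator_space) mnorm_nonneg:
  assumes "x \<in> mats n (carr E)" shows "0 \<le> mnorm E n x"
proof -
  have "(\<lambda>i j. scal E (-1) (x i j)) \<in> mats n (carr E)"
    using assms subspace_scale[OF subspace_carr] unfolding mats_def by blast
  from mnorm_triangle[OF assms this] show ?thesis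
    using mnorm_scal[OF assms, of "-1"] mnorm_zero by simp
qed

lemma (in operator_space) mnorm_sum_le:
  assumes "finite A" "\<And>a. a \<in> A \<Longrightarrow> f a \<in> mats n (carr E)"
  shows "mnorm E n (\<lambda>i j. \<Sum>a\<in>A. f a i j) \<le> (\<Sum>a\<in>A. mnorm E n (f a))"
  using assms
proof (induction A)
  case empty
  then show ?case by (simp add: mnorm_zero)
next
  case (insert a A)
  have "(\<lambda>i j. \<Sum>a\<in>A. f a i j) \<in> mats n (carr E)"
    using insert.prems by (auto simp: mats_def intro!: subspace_sum[OF subspace_carr])
  from mnorm_triangle[OF _ this, of "f a"] insert.prems
  have "mnorm E n (\<lambda>i j. f a i j + (\<Sum>a\<in>A. f a i j))
      \<le> mnorm E n (f a) + mnorm E n (\<lambda>i j. \<Sum>a\<in>A. f a i j)" by blast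
  then show ?case using insert.IH insert.prems insert.hyps by fastforce
qed

lemma bdd_above_scalar_mat_norm:
  fixes a :: "nat \<Rightarrow> nat \<Rightarrow> complex" and m n :: nat
  shows "bdd_above ((\<lambda>v. sqrt (\<Sum>i<m. (cmod (\<Sum>j<n. a i j * v j))\<^sup>2)) `
     {v. (\<Sum>j<n. (cmod (v j))\<^sup>2) \<le> 1})"
proof (rule bdd_aboveI2)
  fix v assume "v \<in> {v. (\<Sum>j<n. (cmod (v j))\<^sup>2) \<le> 1}"
  then have v: "(\<Sum>j<n. (cmod (v j))\<^sup>2) \<le> 1" by simp
  have v1: "cmod (v j) \<le> 1" if "j < n" for j
  proof -
    have "(cmod (v j))\<^sup>2 \<le> (\<Sum>j<n. (cmod (v j))\<^sup>2)" using that by (intro member_le_sum) auto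
    then have "(cmod (v j))\<^sup>2 \<le> 1" using v by linarith
    then show ?thesis by (simp add: power_le_one_iff)
  qed
  have "cmod (\<Sum>j<n. a i j * v j) \<le> (\<Sum>j<n. cmod (a i j))" for i
    using v1 by (intro order_trans[OF norm_sum] sum_mono) (auto simp: norm_mult intro: mult_left_le)
  then show "sqrt (\<Sum>i<m. (cmod (\<Sum>j<n. a i j * v j))\<^sup>2) \<le> sqrt (\<Sum>i<m. (\<Sum>j<n. cmod (a i j))\<^sup>2)"
    by (intro real_sqrt_le_mono sum_mono power_mono) auto
qed

lemma scalar_mat_norm_nonneg: "0 \<le> scalar_mat_norm m n a"
proof -
  have "(\<lambda>_. 0) \<in> {v. (\<Sum>j<n. (cmod (v j))\<^sup>2) \<le> 1}" by simp
  from cSUP_upper[OF this bdd_above_scalar_mat_norm[where m=m and n=n and a=a]] show ?thesis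
    unfolding scalar_mat_norm_def by simp
qed

lemma scalar_mat_norm_le:
  assumes "\<And>v. (\<Sum>j<n. (cmod (v j))\<^sup>2) \<le> 1 \<Longrightarrow> (\<Sum>i<m. (cmod (\<Sum>j<n. a i j * v j))\<^sup>2) \<le> 1"
  shows "scalar_mat_norm m n a \<le> 1"
  unfolding scalar_mat_norm_def
proof (rule cSUP_least)
  have "(\<lambda>_. 0) \<in> {v. (\<Sum>j<n. (cmod (v j))\<^sup>2) \<le> 1}" by simp
  then show "{v. (\<Sum>j<n. (cmod (v j))\<^sup>2) \<le> 1} \<noteq> {}" by (intro iffD1[OF ex_in_conv] exI)
next
  fix v assume "v \<in> {v. (\<Sum>j<n. (cmod (v j))\<^sup>2) \<le> 1}"
  then have "(\<Sum>j<n. (cmod (v j))\<^sup>2) \<le> 1" by simp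
  from assms[OF this] show "sqrt (\<Sum>i<m. (cmod (\<Sum>j<n. a i j * v j))\<^sup>2) \<le> 1" by simp
qed

lemma (in operator_space) mnorm_entry_le:
  assumes z: "z \<in> carr E" and "p < n" "q < n"
  shows "mnorm E n (\<lambda>i j. if p = i \<and> q = j then z else 0) \<le> vnorm E z"
proof -
  let ?a = "\<lambda>i k. if i = p then 1 else (0::complex)"
  let ?b = "\<lambda>l j. if j = q then 1 else (0::complex)"
  have z1: "(\<lambda>_ _. z) \<in> mats 1 (carr E)" using z by (simp add: mats_def)
  have v0: "0 \<le> vnorm E z" using mnorm_nonneg[OF z1] by (simp add: vnorm_def)
  have a: "scalar_mat_norm n 1 ?a \<le> 1"
  proof (rule scalar_mat_norm_le)
    fix v :: "nat \<Rightarrow> complex" assume "(\<Sum>j<1. (cmod (v j))\<^sup>2) \<le> 1"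
    moreover have "(\<Sum>i<n. (cmod (\<Sum>j<1. ?a i j * v j))\<^sup>2) = (\<Sum>i<n. if i = p then (cmod (v 0))\<^sup>2 else 0)"
      by (intro sum.cong) auto
    ultimately show "(\<Sum>i<n. (cmod (\<Sum>j<1. ?a i j * v j))\<^sup>2) \<le> 1" by simp
  qed
  have b: "scalar_mat_norm 1 n ?b \<le> 1"
  proof (rule scalar_mat_norm_le)
    fix v :: "nat \<Rightarrow> complex" assume 1: "(\<Sum>j<n. (cmod (v j))\<^sup>2) \<le> 1"
    have "(\<Sum>j<n. ?b i j * v j) = (\<Sum>j<n. if j = q then v j else 0)" for i :: nat
      by (intro sum.cong) auto
    then have "(\<Sum>i<1::nat. (cmod (\<Sum>j<n. ?b i j * v j))\<^sup>2) = (cmod (v q))\<^sup>2"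
      using \<open>q < n\<close> by simp
    also have "\<dots> \<le> (\<Sum>j<n. (cmod (v j))\<^sup>2)"
      using \<open>q < n\<close> by (intro member_le_sum) auto
    finally show "(\<Sum>i<1::nat. (cmod (\<Sum>j<n. ?b i j * v j))\<^sup>2) \<le> 1" using 1 by linarith
  qed
  have "mnorm E n (\<lambda>i j. if p = i \<and> q = j then z else 0) = mnorm E n (mat_compress E 1 ?a (\<lambda>_ _. z) ?b)"
    by (intro mnorm_cong) (auto simp: mat_compress_def)
  also have "\<dots> \<le> scalar_mat_norm n 1 ?a * vnorm E z * scalar_mat_norm 1 n ?b"
    unfolding vnorm_def by (rule mnorm_compress[OF z1])
  also have "\<dots> \<le> 1 * vnorm E z * 1"
    by (intro mult_mono a b v0 order_refl mult_nonneg_nonneg scalar_mat_norm_nonneg) simp_all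
  finally show ?thesis by simp
qed

lemma (in operator_space) mnorm_le_sum:
  assumes x: "x \<in> mats n (carr E)"
  shows "mnorm E n x \<le> (\<Sum>p<n. \<Sum>q<n. vnorm E (x p q))"
proof -
  let ?A = "{..<n} \<times> {..<n}"
  let ?f = "\<lambda>(p, q) i j. if p = i \<and> q = j then x p q else 0"
  have "mnorm E n x = mnorm E n (\<lambda>i j. \<Sum>a\<in>?A. ?f a i j)"
  proof (rule mnorm_cong)
    fix i j assume ij: "i < n" "j < n"
    have "(\<Sum>a\<in>?A. ?f a i j) = (\<Sum>a\<in>?A. if a = (i, j) then x i j else 0)"
      by (intro sum.cong refl) (simp split: prod.split)
    then show "x i j = (\<Sum>a\<in>?A. ?f a i j)" using ij by simp
  qed
  also have "\<dots> \<le> (\<Sum>a\<in>?A. mnorm E n (?f a))"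
    using x subspace_0[OF subspace_carr] by (intro mnorm_sum_le) (auto simp: mats_def)
  also have "\<dots> \<le> (\<Sum>(p, q)\<in>?A. vnorm E (x p q))"
    using x by (intro sum_mono) (auto simp: mats_def intro!: mnorm_entry_le)
  finally show ?thesis by (simp add: sum.cartesian_product)
qed

lemma (in operator_space) bdd_above_linf:
  assumes "x \<in> mats n (carr (linf E))"
  shows "bdd_above (range (\<lambda>k. mnorm E n (\<lambda>i j. x i j k)))"
proof -
  have "\<exists>C. \<forall>k. vnorm E (x i j k) \<le> C" if "i < n" "j < n" for i j
    using assms that by (auto simp: mats_def linf_def bdd_above_def)
  then obtain C where C: "\<And>i j k. i < n \<Longrightarrow> j < n \<Longrightarrow> vnorm E (x i j k) \<le> C i j" by metis
  show ?thesis
  proof (rule bdd_aboveI2)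
    fix k
    have "mnorm E n (\<lambda>i j. x i j k) \<le> (\<Sum>p<n. \<Sum>q<n. vnorm E (x p q k))"
      using assms by (intro mnorm_le_sum) (auto simp: mats_def linf_def)
    also have "\<dots> \<le> (\<Sum>p<n. \<Sum>q<n. C p q)"
      using C by (intro sum_mono) auto
    finally show "mnorm E n (\<lambda>i j. x i j k) \<le> (\<Sum>p<n. \<Sum>q<n. C p q)" .
  qed
qed

lemma sum_fun_apply: "(\<Sum>a\<in>A. f a) k = (\<Sum>a\<in>A. f a k)" for f :: "'b \<Rightarrow> 'c \<Rightarrow> 'd::comm_monoid_add"
  by (induction A rule: infinite_finite_induct) auto

lemma operator_space_linf:
  assumes "operator_space Z"
  shows "operator_space (linf Z)"
proof -
  interpret Z: operator_space Z by fact
  let ?L = "linf Z"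
  have sc: "scal ?L c f k = scal Z c (f k)" for c f k by (simp add: linf_def)
  have nm: "mnorm ?L n x = (SUP k. mnorm Z n (\<lambda>i j. x i j k))" for n x by (simp add: linf_def)
  have fib: "(\<lambda>i j. x i j k) \<in> mats n (carr Z)" if "x \<in> mats n (carr ?L)" for n x k
    using that by (auto simp: mats_def linf_def)
  have up: "mnorm Z n (\<lambda>i j. x i j k) \<le> mnorm ?L n x" if "x \<in> mats n (carr ?L)" for n x k
    unfolding nm by (rule cSUP_upper[OF _ Z.bdd_above_linf[OF that]]) simp
  have lst: "mnorm ?L n x \<le> C" if "\<And>k. mnorm Z n (\<lambda>i j. x i j k) \<le> C" for n x C
    unfolding nm using that by (intro cSUP_least) auto
  have nn: "0 \<le> mnorm ?L n x" if "x \<in> mats n (carr ?L)" for n x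
    using Z.mnorm_nonneg[OF fib[OF that, of 0]] up[OF that, of 0] by linarith
  have vs: "vector_space (scal ?L)"
    by standard (auto simp: fun_eq_iff sc Z.scale_right_distrib Z.scale_left_distrib)
  interpret L: vector_space "scal ?L" by (rule vs)
  have m1: "(\<lambda>_ _. z) \<in> mats 1 (carr Z)" if "z \<in> carr Z" for z
    using that by (simp add: mats_def)
  have sub: "L.subspace (carr ?L)"
  proof (rule L.subspaceI)
    show "0 \<in> carr ?L"
      using Z.subspace_0[OF Z.subspace_carr] by (auto simp: linf_def)
    fix f g c assume f: "f \<in> carr ?L"
    obtain C where C: "\<And>k. vnorm Z (f k) \<le> C" using f by (auto simp: linf_def bdd_above_def)
    have fk: "f k \<in> carr Z" for k using f by (simp add: linf_def)
    have "vnorm Z (scal Z c (f k)) \<le> cmod c * C" for k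
      using Z.mnorm_scal[OF m1[OF fk], of c k] mult_left_mono[OF C, of "cmod c" k]
      by (simp add: vnorm_def)
    then have "bdd_above (range (\<lambda>k. vnorm Z (scal Z c (f k))))" by (rule bdd_aboveI2)
    then show "scal ?L c f \<in> carr ?L"
      using fk Z.subspace_scale[OF Z.subspace_carr] by (simp add: linf_def)
    assume g: "g \<in> carr ?L"
    obtain D where D: "\<And>k. vnorm Z (g k) \<le> D" using g by (auto simp: linf_def bdd_above_def)
    have gk: "g k \<in> carr Z" for k using g by (simp add: linf_def)
    have "vnorm Z (f k + g k) \<le> C + D" for k
      using Z.mnorm_triangle[OF m1[OF fk] m1[OF gk], of k k] C[of k] D[of k]
      by (simp add: vnorm_def)
    then have "bdd_above (range (\<lambda>k. vnorm Z (f k + g k)))" by (rule bdd_aboveI2)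
    then show "f + g \<in> carr ?L"
      using fk gk Z.subspace_add[OF Z.subspace_carr] by (simp add: linf_def)
  qed
  show ?thesis
  proof (unfold_locales)
    show "L.subspace (carr ?L)" by (rule sub)
  next
    fix n :: nat and x y :: "nat \<Rightarrow> nat \<Rightarrow> nat \<Rightarrow> 'a"
    assume "\<And>i j. i < n \<Longrightarrow> j < n \<Longrightarrow> x i j = y i j"
    then have "mnorm Z n (\<lambda>i j. x i j k) = mnorm Z n (\<lambda>i j. y i j k)" for k
      by (intro Z.mnorm_cong) simp
    then show "mnorm ?L n x = mnorm ?L n y" by (simp add: nm)
  next
    fix n x assume x: "x \<in> mats n (carr ?L)"
    show "mnorm ?L n x = 0 \<longleftrightarrow> (\<forall>i<n. \<forall>j<n. x i j = 0)"
    proof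
      assume 0: "mnorm ?L n x = 0"
      have "mnorm Z n (\<lambda>i j. x i j k) = 0" for k
        using up[OF x, of k] Z.mnorm_nonneg[OF fib[OF x, of k]] 0 by simp
      then have "\<forall>i<n. \<forall>j<n. x i j k = 0" for k using Z.mnorm_eq_0[OF fib[OF x]] by blast
      then show "\<forall>i<n. \<forall>j<n. x i j = 0" by (auto simp: fun_eq_iff)
    next
      assume "\<forall>i<n. \<forall>j<n. x i j = 0"
      then have "mnorm Z n (\<lambda>i j. x i j k) = 0" for k using Z.mnorm_eq_0[OF fib[OF x]] by simp
      then show "mnorm ?L n x = 0" by (simp add: nm)
    qed
  next
    fix n x y assume x: "x \<in> mats n (carr ?L)" and y: "y \<in> mats n (carr ?L)"
    show "mnorm ?L n (\<lambda>i j. x i j + y i j) \<le> mnorm ?L n x + mnorm ?L n y"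
    proof (rule lst)
      fix k show "mnorm Z n (\<lambda>i j. (x i j + y i j) k) \<le> mnorm ?L n x + mnorm ?L n y"
        using Z.mnorm_triangle[OF fib[OF x] fib[OF y], of k k] up[OF x, of k] up[OF y, of k] by simp
    qed
  next
    fix n x c assume x: "x \<in> mats n (carr ?L)"
    have "mnorm ?L n (\<lambda>i j. scal ?L c (x i j)) = (SUP k. cmod c * mnorm Z n (\<lambda>i j. x i j k))"
      using Z.mnorm_scal[OF fib[OF x]] by (simp add: nm sc)
    also have "\<dots> = cmod c * mnorm ?L n x"
    proof (cases "c = 0")
      case False
      have mem: "(\<lambda>i j. scal ?L c (x i j)) \<in> mats n (carr ?L)"
        using x L.subspace_scale[OF sub] by (simp add: mats_def)
      have eq: "mnorm Z n (\<lambda>i j. scal ?L c (x i j) k) = cmod c * mnorm Z n (\<lambda>i j. x i j k)" for k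
        using Z.mnorm_scal[OF fib[OF x]] by (simp add: sc)
      show ?thesis
      proof (rule antisym)
        show "(SUP k. cmod c * mnorm Z n (\<lambda>i j. x i j k)) \<le> cmod c * mnorm ?L n x"
          by (intro cSUP_least) (auto intro!: mult_left_mono up[OF x])
        have "mnorm ?L n x \<le> mnorm ?L n (\<lambda>i j. scal ?L c (x i j)) / cmod c"
          using up[OF mem] False by (intro lst) (simp add: eq field_simps)
        then show "cmod c * mnorm ?L n x \<le> (SUP k. cmod c * mnorm Z n (\<lambda>i j. x i j k))"
          using False eq by (simp add: nm field_simps)
      qed
    qed simp
    finally show "mnorm ?L n (\<lambda>i j. scal ?L c (x i j)) = cmod c * mnorm ?L n x" .
  next
    fix m n x y assume x: "x \<in> mats m (carr ?L)" and y: "y \<in> mats n (carr ?L)"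
    have eq: "mnorm Z (m + n) (\<lambda>i j. mat_dsum m x y i j k)
        = max (mnorm Z m (\<lambda>i j. x i j k)) (mnorm Z n (\<lambda>i j. y i j k))" for k
    proof -
      have "(\<lambda>i j. mat_dsum m x y i j k) = mat_dsum m (\<lambda>i j. x i j k) (\<lambda>i j. y i j k)"
        by (auto simp: mat_dsum_def fun_eq_iff)
      then show ?thesis using Z.mnorm_dsum[OF fib[OF x] fib[OF y], of k k] by simp
    qed
    have mem: "mat_dsum m x y \<in> mats (m + n) (carr ?L)"
      using x y L.subspace_0[OF sub] by (auto simp: mats_def mat_dsum_def)
    show "mnorm ?L (m + n) (mat_dsum m x y) = max (mnorm ?L m x) (mnorm ?L n y)"
    proof (rule antisym)
      show "mnorm ?L (m + n) (mat_dsum m x y) \<le> max (mnorm ?L m x) (mnorm ?L n y)"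
        unfolding nm[of "m + n"] eq using up[OF x] up[OF y]
        by (intro cSUP_least) (auto intro: max.coboundedI1 max.coboundedI2)
      show "max (mnorm ?L m x) (mnorm ?L n y) \<le> mnorm ?L (m + n) (mat_dsum m x y)"
        using up[OF mem] unfolding eq by (intro max.boundedI lst) auto
    qed
  next
    fix m n a x b assume x: "x \<in> mats n (carr ?L)"
    show "mnorm ?L m (mat_compress ?L n a x b)
            \<le> scalar_mat_norm m n a * mnorm ?L n x * scalar_mat_norm n m b"
    proof (rule lst)
      fix k
      have "(\<lambda>i j. mat_compress ?L n a x b i j k) = mat_compress Z n a (\<lambda>i j. x i j k) b"
        by (auto simp: mat_compress_def fun_eq_iff sum_fun_apply sc)
      then have "mnorm Z m (\<lambda>i j. mat_compress ?L n a x b i j k)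
          \<le> scalar_mat_norm m n a * mnorm Z n (\<lambda>i j. x i j k) * scalar_mat_norm n m b"
        using Z.mnorm_compress[OF fib[OF x]] by simp
      also have "\<dots> \<le> scalar_mat_norm m n a * mnorm ?L n x * scalar_mat_norm n m b"
        by (intro mult_right_mono mult_left_mono up[OF x] scalar_mat_norm_nonneg)
      finally show "mnorm Z m (\<lambda>i j. mat_compress ?L n a x b i j k)
          \<le> scalar_mat_norm m n a * mnorm ?L n x * scalar_mat_norm n m b" .
    qed
  qed
qed

end

theory Submission
  imports Defs
begin

text \<open>
  The proof adapts Veech's proof of Sobczyk's theorem. A projection \<open>P\<close> onto \<open>c\<^sub>0(Z)\<close> is the same
  thing as its complement \<open>I - P\<close>, which sends \<open>y\<close> to a sequence \<open>(\<phi>\<^sub>k y)\<^sub>k\<close>. Since the matrix norms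
  of \<open>\<ell>\<^sup>\<infinity>(Z)\<close> are suprema over coordinates, \<open>I - P\<close> is completely contractive as soon as every
  \<open>\<phi>\<^sub>k\<close> is; \<open>P\<close> fixes \<open>c\<^sub>0(Z)\<close> as soon as every \<open>\<phi>\<^sub>k\<close> vanishes there; and \<open>P\<close> takes its values in
  \<open>c\<^sub>0(Z)\<close> if \<open>y\<^sub>k - \<phi>\<^sub>k y\<close> tends to 0 for every \<open>y\<close> in \<open>Y\<close>. So it suffices to approximate the
  coordinate maps \<open>\<pi>\<^sub>k y = y\<^sub>k\<close> by members \<open>\<phi>\<^sub>k\<close> of the set \<open>K\<close> of complete contractions into \<open>Z\<close>
  that vanish on \<open>c\<^sub>0(Z)\<close>.

  The \<open>\<pi>\<^sub>k\<close> are complete contractions and \<open>\<pi>\<^sub>k y\<close> tends to 0 for \<open>y\<close> in \<open>c\<^sub>0(Z)\<close>, so every pointwise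
  cluster point of the sequence \<open>(\<pi>\<^sub>k)\<close> belongs to \<open>K\<close>
  (\<open>limit_of_coordinates_in_contractions_mod_c0\<close>). Because \<open>Z\<close> is finite-dimensional, Tychonoff's
  theorem gives such cluster points for every subsequence
  (\<open>finite_dimensional_simultaneous_limits\<close>). Hence, on a given finite set of vectors and for a given
  tolerance, all but finitely many \<open>\<pi>\<^sub>k\<close> are close to \<open>K\<close>: otherwise a cluster point of the exceptional
  \<open>\<pi>\<^sub>k\<close> would be a member of \<open>K\<close> close to one of them (\<open>coordinates_near_contractions_mod_c0\<close>).

  Separability turns these finite approximations into a single sequence \<open>(\<phi>\<^sub>k)\<close>: a diagonal choice
  makes \<open>y\<^sub>k - \<phi>\<^sub>k y\<close> tend to 0 for all \<open>y\<close> in a countable dense set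
  (\<open>contractions_mod_c0_approximating_coordinates\<close>), and contractivity of \<open>\<pi>\<^sub>k\<close> and \<open>\<phi>\<^sub>k\<close> extends
  this to the closure.
\<close>

section \<open>The vector norm of an operator space\<close>

context operator_space
begin

lemma const_mats: "z \<in> carr E \<Longrightarrow> (\<lambda>_ _. z) \<in> mats n (carr E)"
  by (simp add: mats_def)

lemma vnorm_nonneg: "z \<in> carr E \<Longrightarrow> 0 \<le> vnorm E z"
  unfolding vnorm_def by (intro mnorm_nonneg const_mats)

lemma vnorm_0: "vnorm E 0 = 0"
  unfolding vnorm_def by (rule mnorm_zero)

lemma vnorm_eq_0: "z \<in> carr E \<Longrightarrow> vnorm E z = 0 \<longleftrightarrow> z = 0"
  unfolding vnorm_def using mnorm_eq_0[OF const_mats] by auto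

lemma vnorm_triangle:
  "z \<in> carr E \<Longrightarrow> w \<in> carr E \<Longrightarrow> vnorm E (z + w) \<le> vnorm E z + vnorm E w"
  unfolding vnorm_def using mnorm_triangle[OF const_mats const_mats] by blast

lemma vnorm_scal: "z \<in> carr E \<Longrightarrow> vnorm E (scal E c z) = cmod c * vnorm E z"
  unfolding vnorm_def using mnorm_scal[OF const_mats] by blast

lemma vnorm_minus_commute:
  assumes "z \<in> carr E" "w \<in> carr E" shows "vnorm E (z - w) = vnorm E (w - z)"
proof -
  have "scal E (-1) (w - z) = z - w" by simp
  then show ?thesis
    using vnorm_scal[OF subspace_diff[OF subspace_carr assms(2,1)], of "-1"] by simp
qed

lemma vnorm_triangle3:
  assumes "x \<in> carr E" "y \<in> carr E" "z \<in> carr E"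
  shows "vnorm E (x - z) \<le> vnorm E (x - y) + vnorm E (y - z)"
  using vnorm_triangle[of "x - y" "y - z"] assms subspace_diff[OF subspace_carr] by simp

lemma vnorm_triangle_diff:
  assumes "x \<in> carr E" "y \<in> carr E"
  shows "vnorm E x \<le> vnorm E y + vnorm E (x - y)"
  using vnorm_triangle[of y "x - y"] assms subspace_diff[OF subspace_carr] by simp

lemma vnorm_sum_le:
  assumes "finite A" "\<And>a. a \<in> A \<Longrightarrow> f a \<in> carr E"
  shows "vnorm E (\<Sum>a\<in>A. f a) \<le> (\<Sum>a\<in>A. vnorm E (f a))"
  using mnorm_sum_le[of A "\<lambda>a _ _. f a"] assms unfolding vnorm_def by (simp add: mats_def)

lemma vnorm_limit_unique:
  assumes "G \<noteq> bot" "z \<in> carr E" "w \<in> carr E" "\<And>k. f k \<in> carr E"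
    and z: "((\<lambda>k. vnorm E (f k - z)) \<longlongrightarrow> 0) G" and w: "((\<lambda>k. vnorm E (f k - w)) \<longlongrightarrow> 0) G"
  shows "z = w"
proof -
  have "vnorm E (z - w) \<le> vnorm E (f k - z) + vnorm E (f k - w)" for k
    using vnorm_triangle3[of z "f k" w] vnorm_minus_commute[of z "f k"] assms(2,3,4) by simp
  then have "vnorm E (z - w) \<le> 0 + 0"
    by (intro tendsto_lowerbound[OF tendsto_add[OF z w] _ assms(1)]) simp
  then have "vnorm E (z - w) = 0"
    using vnorm_nonneg[of "z - w"] subspace_diff[OF subspace_carr assms(2,3)] by simp
  then show ?thesis using vnorm_eq_0 subspace_diff[OF subspace_carr assms(2,3)] by simp
qed

end

lemma tendsto_0_squeeze:
  fixes f g :: "'k \<Rightarrow> real"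
  assumes "\<And>k. f k \<le> g k" "\<And>k. 0 \<le> f k" "(g \<longlongrightarrow> 0) G"
  shows "(f \<longlongrightarrow> 0) G"
  by (rule tendsto_sandwich[OF _ _ tendsto_const assms(3)]) (simp_all add: assms)

section \<open>Compactness in finite dimension\<close>

lemma compact_polydisc: "compact (PiE UNIV (\<lambda>i. cball (0::complex) (C i)))"
  using compactin_PiE[of "\<lambda>_. euclidean" UNIV "\<lambda>i. cball (0::complex) (C i)"]
  by (simp add: euclidean_product_topology)

text \<open>
  Pointwise cluster points exist by Tychonoff's theorem. Passing to a finer filter, in place of a
  subsequence, makes all coordinates converge at once even though the index type may be uncountable.
\<close>

lemma pointwise_bounded_cluster_point:
  fixes c :: "'k \<Rightarrow> 'i \<Rightarrow> complex"
  assumes "F \<noteq> bot" and c: "\<And>k i. cmod (c k i) \<le> C i"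
  obtains G l where "G \<le> F" "G \<noteq> bot" "\<And>i. ((\<lambda>k. c k i) \<longlongrightarrow> l i) G"
proof -
  let ?K = "PiE UNIV (\<lambda>i. cball 0 (C i)) :: ('i \<Rightarrow> complex) set"
  have K: "compact ?K" by (rule compact_polydisc)
  have "filtermap c F \<noteq> bot" "eventually (\<lambda>x. x \<in> ?K) (filtermap c F)"
    using assms by (auto simp: filtermap_bot_iff eventually_filtermap PiE_iff)
  then obtain l where l: "inf (nhds l) (filtermap c F) \<noteq> bot"
    using K unfolding compact_filter by blast
  \<comment> \<open>The cluster point makes the neighbourhoods of \<open>l\<close>, pulled back along \<open>c\<close>, compatible with \<open>F\<close>.\<close>
  let ?G = "inf (filtercomap c (nhds l)) F"
  have "filtermap c ?G \<noteq> bot"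
  proof
    assume "filtermap c ?G = bot"
    then have "?G = bot" by (simp add: filtermap_bot_iff)
    then obtain P Q where P: "eventually P (nhds l)" and Q: "eventually Q F"
      and PQ: "\<And>k. P (c k) \<Longrightarrow> Q k \<Longrightarrow> False"
      unfolding trivial_limit_def eventually_inf eventually_filtercomap by blast
    have "eventually (\<lambda>x. \<not> P x) (filtermap c F)"
      unfolding eventually_filtermap using Q by eventually_elim (use PQ in blast)
    with P have "eventually (\<lambda>_. False) (inf (nhds l) (filtermap c F))"
      unfolding eventually_inf by blast
    with l show False by (simp add: trivial_limit_def)
  qed
  then have G: "?G \<noteq> bot" by auto
  have "(c \<longlongrightarrow> l) ?G"
    by (rule filterlim_mono[OF filterlim_filtercomap order_refl inf_le1])
  moreover have "((\<lambda>x. x i) \<longlongrightarrow> l i) (nhds l)" for i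
  proof -
    have "continuous_on UNIV (\<lambda>x :: 'i \<Rightarrow> complex. x i)" by (rule continuous_on_product_coordinates)
    then have "((\<lambda>x. x i) \<longlongrightarrow> l i) (at l)" by (simp add: continuous_on_def)
    then show ?thesis using tendsto_at_iff_tendsto_nhds[of "\<lambda>x. x i" l] by simp
  qed
  ultimately have "((\<lambda>k. c k i) \<longlongrightarrow> l i) ?G" for i
    by (rule filterlim_compose[rotated])
  with G that[of ?G l] show thesis by simp
qed

context operator_space
begin

text \<open>
  The equivalence of norms in finite dimension: the norm is a continuous positive function of the
  coefficients on the unit sphere of the maximum norm, so it has a positive minimum \<open>m\<close> there, and
  \<open>1 / m\<close> is the constant by homogeneity.
\<close>

lemma coefficients_bounded_by_vnorm:
  assumes B: "finite B" "independent B" "B \<subseteq> carr E"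
  obtains M where "\<And>u b. b \<in> B \<Longrightarrow> cmod (u b) \<le> M * vnorm E (\<Sum>b\<in>B. scal E (u b) b)"
proof -
  let ?s = "\<lambda>u. \<Sum>b\<in>B. scal E (u b) b"
  let ?N = "\<lambda>u. vnorm E (?s u)"
  have mem: "?s u \<in> carr E" for u
    using B(3) by (intro subspace_sum[OF subspace_carr] subspace_scale[OF subspace_carr]) auto
  have lip: "?N u - ?N v \<le> (\<Sum>b\<in>B. cmod (u b - v b) * vnorm E b)" for u v
  proof -
    have "?s u - ?s v = (\<Sum>b\<in>B. scal E (u b - v b) b)"
      by (simp add: sum_subtractf scale_left_diff_distrib)
    also have "vnorm E \<dots> \<le> (\<Sum>b\<in>B. vnorm E (scal E (u b - v b) b))"
      using B by (intro vnorm_sum_le subspace_scale[OF subspace_carr]) auto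
    also have "\<dots> = (\<Sum>b\<in>B. cmod (u b - v b) * vnorm E b)"
      using B by (intro sum.cong refl vnorm_scal) auto
    finally show ?thesis using vnorm_triangle_diff[OF mem[of u] mem[of v]] by simp
  qed
  have co: "continuous_on UNIV (\<lambda>u :: 'a \<Rightarrow> complex. u b)" for b
    by (rule continuous_on_product_coordinates)
  have cont: "continuous_on A ?N" for A
  proof (rule continuous_on_subset[of UNIV], unfold continuous_on_def, intro ballI)
    fix v :: "'a \<Rightarrow> complex"
    have t: "((\<lambda>u :: 'a \<Rightarrow> complex. u b) \<longlongrightarrow> v b) (at v)" for b
      using co[of b] by (simp add: continuous_on_def)
    have "((\<lambda>u. \<Sum>b\<in>B. cmod (u b - v b) * vnorm E b) \<longlongrightarrow> (\<Sum>b\<in>B. cmod (v b - v b) * vnorm E b)) (at v)"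
      by (intro tendsto_intros t)
    then have lim: "((\<lambda>u. \<Sum>b\<in>B. cmod (u b - v b) * vnorm E b) \<longlongrightarrow> 0) (at v)" by simp
    have "\<bar>?N u - ?N v\<bar> \<le> (\<Sum>b\<in>B. cmod (u b - v b) * vnorm E b)" for u
      using lip[of u v] lip[of v u] by (simp add: norm_minus_commute)
    then have "((\<lambda>u. ?N u - ?N v) \<longlongrightarrow> 0) (at v)"
      by (intro Lim_null_comparison[OF _ lim]) (simp add: always_eventually)
    then show "(?N \<longlongrightarrow> ?N v) (at v within UNIV)" by (simp add: LIM_zero_iff)
  qed simp
  \<comment> \<open>Coefficient vectors are functions on the whole type. Bounding also the values outside \<open>B\<close> makes
    the unit sphere compact in the product topology.\<close>
  let ?S = "{u. \<exists>b\<in>B. cmod (u b) = 1} \<inter> PiE UNIV (\<lambda>_. cball (0::complex) 1)"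
  have "closed {u. cmod (u b) = 1}" for b :: 'a
    by (rule closed_Collect_eq[OF continuous_on_norm[OF co] continuous_on_const])
  then have "closed (\<Union>b\<in>B. {u. cmod (u b) = 1})" using B(1) by (intro closed_UN) auto
  moreover have "(\<Union>b\<in>B. {u. cmod (u b) = 1}) = {u. \<exists>b\<in>B. cmod (u b) = 1}" by auto
  moreover have "compact (PiE (UNIV::'a set) (\<lambda>_. cball (0::complex) 1))"
    by (rule compact_polydisc)
  ultimately have S: "compact ?S" by (simp only: closed_Int_compact)
  have pos: "0 < ?N u" if "u \<in> ?S" for u
  proof -
    obtain b where b: "b \<in> B" "cmod (u b) = 1" using \<open>u \<in> ?S\<close> by blast
    then have "u b \<noteq> 0" by auto
    with b(1) have "?s u \<noteq> 0" using independentD[OF B(2,1) order_refl, of u b] by blast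
    then show ?thesis using vnorm_eq_0[OF mem[of u]] vnorm_nonneg[OF mem[of u]] by simp
  qed
  obtain m where m: "0 < m" "\<And>u. u \<in> ?S \<Longrightarrow> m \<le> ?N u"
  proof (cases "?S = {}")
    case False
    then obtain w where "w \<in> ?S" "\<forall>u\<in>?S. ?N w \<le> ?N u"
      using continuous_attains_inf[OF S _ cont] by blast
    with pos that show thesis by blast
  qed (use that[of 1] in simp)
  have "cmod (u b) \<le> (1 / m) * ?N u" if b: "b \<in> B" for u b
  proof -
    let ?t = "Max ((\<lambda>b. cmod (u b)) ` B)"
    have t: "cmod (u b) \<le> ?t" if "b \<in> B" for b using that B(1) by simp
    have "?t \<in> (\<lambda>b. cmod (u b)) ` B" using b B(1) by (intro Max_in) auto
    then obtain b' where b': "b' \<in> B" "cmod (u b') = ?t" by auto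
    show ?thesis
    proof (cases "?t = 0")
      case True
      then show ?thesis using t[OF b] vnorm_nonneg[OF mem[of u]] m(1) by (simp add: order_trans)
    next
      case False
      then have t0: "0 < ?t" using b' by (metis norm_ge_zero order_less_le)
      let ?v = "\<lambda>b. if b \<in> B then u b / of_real ?t else 0"
      have "cmod (?v b') = 1" using b' t0 by (simp add: norm_divide)
      moreover have "cmod (?v b) \<le> 1" for b using t[of b] t0 by (simp add: norm_divide)
      ultimately have "?v \<in> ?S" unfolding PiE_UNIV_domain using b'(1)
        by (intro IntI CollectI Pi_I) (blast, simp only: mem_cball_0)
      then have "m \<le> ?N ?v" by (rule m(2))
      also have "?s ?v = scal E (1 / of_real ?t) (?s u)"
        by (simp add: scale_sum_right)
      also have "vnorm E \<dots> = ?N u / ?t" using vnorm_scal[OF mem] t0 by (simp add: norm_divide)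
      finally have "m * ?t \<le> ?N u" using t0 by (simp add: field_simps)
      then have "?t \<le> (1 / m) * ?N u" using m(1) by (simp add: field_simps)
      then show ?thesis using t[OF b] by (rule order_trans[rotated])
    qed
  qed
  then show thesis by (rule that)
qed

text \<open>
  Bounded families have bounded coefficients with respect to a basis, so the coefficients of all
  members \<open>h i\<close> can be made to converge along one finer filter.
\<close>

lemma finite_dimensional_simultaneous_limits:
  fixes h :: "'i \<Rightarrow> 'k \<Rightarrow> 'a"
  assumes fd: "finite_dimensional E" and F: "F \<noteq> bot"
    and h: "\<And>i k. i \<in> I \<Longrightarrow> h i k \<in> carr E"
    and bdd: "\<And>i. i \<in> I \<Longrightarrow> bdd_above (range (\<lambda>k. vnorm E (h i k)))"
  shows "\<exists>G \<phi>. G \<le> F \<and> G \<noteq> bot \<and>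
    (\<forall>i\<in>I. \<phi> i \<in> carr E \<and> ((\<lambda>k. vnorm E (h i k - \<phi> i)) \<longlongrightarrow> 0) G)"
proof -
  obtain B0 where "finite B0" "span B0 = carr E" using fd unfolding finite_dimensional_def by blast
  moreover obtain B where B: "B \<subseteq> B0" "independent B" "B0 \<subseteq> span B"
    using maximal_independent_subset by blast
  ultimately have fB: "finite B" and sp: "span B = carr E" and Bc: "B \<subseteq> carr E"
    using finite_subset span_superset subset_antisym[OF span_minimal[OF B(3) subspace_span] span_mono[OF B(1)]]
    by auto
  obtain M where M: "\<And>u b. b \<in> B \<Longrightarrow> cmod (u b) \<le> M * vnorm E (\<Sum>b\<in>B. scal E (u b) b)"
    using coefficients_bounded_by_vnorm[OF fB B(2) Bc] by blast
  have "\<exists>u. h i k = (\<Sum>b\<in>B. scal E (u b) b)" if "i \<in> I" for i k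
    using h[OF that, of k] unfolding sp[symmetric] span_finite[OF fB] by auto
  then obtain u where u: "\<And>i k. i \<in> I \<Longrightarrow> h i k = (\<Sum>b\<in>B. scal E (u i k b) b)" by metis
  obtain C where C: "\<And>i k. i \<in> I \<Longrightarrow> vnorm E (h i k) \<le> C i"
    using bdd unfolding bdd_above_def by (metis rangeI)
  let ?c = "\<lambda>k (i, b). if i \<in> I \<and> b \<in> B then u i k b else 0"
  have "cmod (?c k p) \<le> (case p of (i, b) \<Rightarrow> \<bar>M\<bar> * \<bar>C i\<bar>)" for k p
  proof (cases p)
    case (Pair i b)
    have "cmod (u i k b) \<le> \<bar>M\<bar> * \<bar>C i\<bar>" if "i \<in> I" "b \<in> B"
    proof -
      have "cmod (u i k b) \<le> M * vnorm E (h i k)" using M[OF that(2)] u[OF that(1)] by simp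
      also have "\<dots> \<le> \<bar>M\<bar> * \<bar>C i\<bar>"
        using C[OF that(1), of k] vnorm_nonneg[OF h[OF that(1)], of k] by (intro mult_mono) auto
      finally show ?thesis .
    qed
    then show ?thesis using Pair by simp
  qed
  from pointwise_bounded_cluster_point[of F ?c, OF F this]
  obtain G l where G: "G \<le> F" "G \<noteq> bot" and l: "\<And>p. ((\<lambda>k. ?c k p) \<longlongrightarrow> l p) G" by blast
  have lb: "((\<lambda>k. u i k b) \<longlongrightarrow> l (i, b)) G" if "i \<in> I" "b \<in> B" for i b
    using l[of "(i, b)"] that by simp
  let ?\<phi> = "\<lambda>i. \<Sum>b\<in>B. scal E (l (i, b)) b"
  have \<phi>: "?\<phi> i \<in> carr E" for i
    using Bc by (intro subspace_sum[OF subspace_carr] subspace_scale[OF subspace_carr]) auto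
  have "((\<lambda>k. vnorm E (h i k - ?\<phi> i)) \<longlongrightarrow> 0) G" if i: "i \<in> I" for i
  proof -
    have "((\<lambda>k. \<Sum>b\<in>B. cmod (u i k b - l (i, b)) * vnorm E b)
        \<longlongrightarrow> (\<Sum>b\<in>B. cmod (l (i, b) - l (i, b)) * vnorm E b)) G"
      by (intro tendsto_intros lb i)
    then have lim: "((\<lambda>k. \<Sum>b\<in>B. cmod (u i k b - l (i, b)) * vnorm E b) \<longlongrightarrow> 0) G" by simp
    have "norm (vnorm E (h i k - ?\<phi> i)) \<le> (\<Sum>b\<in>B. cmod (u i k b - l (i, b)) * vnorm E b)" for k
    proof -
      have "h i k - ?\<phi> i = (\<Sum>b\<in>B. scal E (u i k b - l (i, b)) b)"
        by (simp add: u[OF i] sum_subtractf scale_left_diff_distrib)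
      also have "vnorm E \<dots> \<le> (\<Sum>b\<in>B. vnorm E (scal E (u i k b - l (i, b)) b))"
        using Bc by (intro vnorm_sum_le fB subspace_scale[OF subspace_carr]) auto
      also have "\<dots> = (\<Sum>b\<in>B. cmod (u i k b - l (i, b)) * vnorm E b)"
        using Bc by (intro sum.cong refl vnorm_scal) auto
      finally show ?thesis
        using vnorm_nonneg[OF subspace_diff[OF subspace_carr h[OF i] \<phi>]] by simp
    qed
    then show ?thesis by (intro Lim_null_comparison[OF _ lim]) (simp add: always_eventually)
  qed
  with G \<phi> show ?thesis by (intro exI[of _ G] exI[of _ ?\<phi>]) simp
qed

end

section \<open>Complete contractions that vanish on null sequences\<close>

definition contractions_mod_c0 :: "('a::ab_group_add) opspace \<Rightarrow> ((nat \<Rightarrow> 'a) \<Rightarrow> 'a) set" where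
  "contractions_mod_c0 Z = {\<phi>. linear_map (linf Z) Z \<phi> \<and>
     (\<forall>n. \<forall>x\<in>mats n (carr (linf Z)). mnorm Z n (\<lambda>i j. \<phi> (x i j)) \<le> mnorm (linf Z) n x) \<and>
     (\<forall>f\<in>c0 Z. \<phi> f = 0)}"

context operator_space
begin

lemma linf_nth: "f \<in> carr (linf E) \<Longrightarrow> f k \<in> carr E"
  by (simp add: linf_def)

lemma mnorm_nth_le:
  assumes "x \<in> mats n (carr (linf E))"
  shows "mnorm E n (\<lambda>i j. x i j k) \<le> mnorm (linf E) n x"
  using cSUP_upper[OF _ bdd_above_linf[OF assms], of k] by (simp add: linf_def)

lemma vnorm_nth_le: "f \<in> carr (linf E) \<Longrightarrow> vnorm E (f k) \<le> vnorm (linf E) f"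
  using mnorm_nth_le[of "\<lambda>_ _. f" 1 k] by (simp add: mats_def vnorm_def)

text \<open>
  Each \<open>f \<mapsto> f k\<close> is a linear complete contraction. Linearity and the bound on every matrix norm pass to
  pointwise limits, because a matrix norm is at most the sum of the norms of the entries. The
  limit vanishes on null sequences because the filter forces \<open>k\<close> to infinity.
\<close>

lemma limit_of_coordinates_in_contractions_mod_c0:
  assumes G: "G \<noteq> bot" "G \<le> sequentially"
    and \<phi>: "\<And>f. f \<in> carr (linf E) \<Longrightarrow> \<phi> f \<in> carr E"
    and lim: "\<And>f. f \<in> carr (linf E) \<Longrightarrow> ((\<lambda>k. vnorm E (f k - \<phi> f)) \<longlongrightarrow> 0) G"
  shows "\<phi> \<in> contractions_mod_c0 E"
proof -
  interpret L: operator_space "linf E" by (rule operator_space_linf) unfold_locales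
  note add = subspace_add[OF subspace_carr] and scale = subspace_scale[OF subspace_carr]
    and diff = subspace_diff[OF subspace_carr]
    and Ladd = L.subspace_add[OF L.subspace_carr] and Lscale = L.subspace_scale[OF L.subspace_carr]
  have "\<phi> (f + g) = \<phi> f + \<phi> g" if f: "f \<in> carr (linf E)" and g: "g \<in> carr (linf E)" for f g
  proof (rule vnorm_limit_unique[OF G(1)])
    show "((\<lambda>k. vnorm E ((f + g) k - \<phi> (f + g))) \<longlongrightarrow> 0) G" by (intro lim Ladd f g)
    have "vnorm E ((f + g) k - (\<phi> f + \<phi> g)) \<le> vnorm E (f k - \<phi> f) + vnorm E (g k - \<phi> g)" for k
      using vnorm_triangle[OF diff[OF linf_nth[OF f] \<phi>[OF f]] diff[OF linf_nth[OF g] \<phi>[OF g]], of k k]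
      by (simp add: algebra_simps)
    moreover have "0 \<le> vnorm E ((f + g) k - (\<phi> f + \<phi> g))" for k
      by (intro vnorm_nonneg diff add linf_nth[OF Ladd[OF f g]] \<phi> f g)
    moreover have "((\<lambda>k. vnorm E (f k - \<phi> f) + vnorm E (g k - \<phi> g)) \<longlongrightarrow> 0) G"
      using tendsto_add[OF lim[OF f] lim[OF g]] by simp
    ultimately show "((\<lambda>k. vnorm E ((f + g) k - (\<phi> f + \<phi> g))) \<longlongrightarrow> 0) G"
      by (rule tendsto_0_squeeze)
  qed (intro \<phi> add Ladd linf_nth[OF Ladd[OF f g]] f g)+
  moreover have "\<phi> (scal (linf E) c f) = scal E c (\<phi> f)" if f: "f \<in> carr (linf E)" for f c
  proof (rule vnorm_limit_unique[OF G(1)])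
    show "((\<lambda>k. vnorm E (scal (linf E) c f k - \<phi> (scal (linf E) c f))) \<longlongrightarrow> 0) G"
      by (intro lim Lscale f)
    have "vnorm E (scal (linf E) c f k - scal E c (\<phi> f)) = cmod c * vnorm E (f k - \<phi> f)" for k
      using vnorm_scal[OF diff[OF linf_nth[OF f] \<phi>[OF f]]]
      by (simp add: linf_def scale_right_diff_distrib)
    then show "((\<lambda>k. vnorm E (scal (linf E) c f k - scal E c (\<phi> f))) \<longlongrightarrow> 0) G"
      using tendsto_mult_right_zero[OF lim[OF f], of "cmod c"] by simp
  qed (intro \<phi> scale Lscale linf_nth[OF Lscale[OF f]] f)+
  ultimately have "linear_map (linf E) E \<phi>" using \<phi> by (auto simp: linear_map_def)
  moreover have "mnorm E n (\<lambda>i j. \<phi> (x i j)) \<le> mnorm (linf E) n x"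
    if x: "x \<in> mats n (carr (linf E))" for n x
  proof -
    have xe: "x i j \<in> carr (linf E)" if "i < n" "j < n" for i j
      using x that by (simp add: mats_def)
    then have nth: "x i j k \<in> carr E" if "i < n" "j < n" for i j k
      using linf_nth that by blast
    let ?e = "\<lambda>k. \<Sum>p<n. \<Sum>q<n. vnorm E (x p q k - \<phi> (x p q))"
    have "mnorm E n (\<lambda>i j. \<phi> (x i j)) \<le> mnorm (linf E) n x + ?e k" for k
    proof -
      have y: "(\<lambda>i j. x i j k) \<in> mats n (carr E)" using nth by (simp add: mats_def)
      have d: "(\<lambda>i j. \<phi> (x i j) - x i j k) \<in> mats n (carr E)"
        using xe nth by (auto simp: mats_def intro!: diff \<phi>)
      have "mnorm E n (\<lambda>i j. \<phi> (x i j))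
          \<le> mnorm E n (\<lambda>i j. x i j k) + mnorm E n (\<lambda>i j. \<phi> (x i j) - x i j k)"
        using mnorm_triangle[OF y d] by simp
      also have "\<dots> \<le> mnorm (linf E) n x + (\<Sum>p<n. \<Sum>q<n. vnorm E (\<phi> (x p q) - x p q k))"
        by (intro add_mono mnorm_nth_le[OF x] mnorm_le_sum d)
      also have "\<dots> = mnorm (linf E) n x + ?e k"
        by (intro arg_cong2[where f="(+)"] refl sum.cong vnorm_minus_commute \<phi> nth xe) auto
      finally show ?thesis .
    qed
    then have ev: "\<forall>\<^sub>F k in G. mnorm E n (\<lambda>i j. \<phi> (x i j)) \<le> mnorm (linf E) n x + ?e k"
      by (intro always_eventually allI)
    have "((\<lambda>k. mnorm (linf E) n x + ?e k)
        \<longlongrightarrow> mnorm (linf E) n x + (\<Sum>p<n. \<Sum>q<n. 0)) G"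
      by (intro tendsto_intros lim xe) auto
    from tendsto_lowerbound[OF this ev G(1)] show ?thesis by simp
  qed
  moreover have "\<phi> f = 0" if f: "f \<in> c0 E" for f
  proof (rule vnorm_limit_unique[OF G(1)])
    have fL: "f \<in> carr (linf E)" using f by (simp add: c0_def)
    show "((\<lambda>k. vnorm E (f k - \<phi> f)) \<longlongrightarrow> 0) G" by (rule lim[OF fL])
    show "((\<lambda>k. vnorm E (f k - 0)) \<longlongrightarrow> 0) G"
      using f by (auto simp: c0_def intro: tendsto_mono[OF G(2)])
    show "\<phi> f \<in> carr E" "f k \<in> carr E" for k by (rule \<phi>[OF fL], rule linf_nth[OF fL])
  qed (rule subspace_0[OF subspace_carr])
  ultimately show ?thesis by (simp add: contractions_mod_c0_def)
qed

text \<open>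
  If infinitely many \<open>k\<close> failed, then the coordinate maps at these \<open>k\<close> would have a cluster point, which
  is itself a contraction of the required kind and is close on \<open>A\<close> to some of them.
\<close>

lemma coordinates_near_contractions_mod_c0:
  assumes fd: "finite_dimensional E" and A: "finite A" "A \<subseteq> carr (linf E)" and "0 < \<epsilon>"
  shows "\<forall>\<^sub>F k in sequentially. \<exists>\<phi>\<in>contractions_mod_c0 E. \<forall>f\<in>A. vnorm E (f k - \<phi> f) < \<epsilon>"
proof (rule ccontr)
  let ?good = "\<lambda>k. \<exists>\<phi>\<in>contractions_mod_c0 E. \<forall>f\<in>A. vnorm E (f k - \<phi> f) < \<epsilon>"
  let ?F = "inf sequentially (principal {k. \<not> ?good k})"
  assume "\<not> eventually ?good sequentially"
  then have F: "?F \<noteq> bot"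
    unfolding trivial_limit_def eventually_inf_principal by simp
  have "\<exists>G \<phi>. G \<le> ?F \<and> G \<noteq> bot \<and>
    (\<forall>f\<in>carr (linf E). \<phi> f \<in> carr E \<and> ((\<lambda>k. vnorm E (f k - \<phi> f)) \<longlongrightarrow> 0) G)"
    by (rule finite_dimensional_simultaneous_limits[OF fd F]) (simp_all add: linf_def)
  then obtain G \<phi> where G: "G \<le> ?F" "G \<noteq> bot"
    and *: "\<forall>f\<in>carr (linf E). \<phi> f \<in> carr E \<and> ((\<lambda>k. vnorm E (f k - \<phi> f)) \<longlongrightarrow> 0) G"
    by (elim exE conjE)
  have \<phi>: "\<phi> f \<in> carr E" and lim: "((\<lambda>k. vnorm E (f k - \<phi> f)) \<longlongrightarrow> 0) G"
    if "f \<in> carr (linf E)" for f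
    using * that by simp_all
  have "G \<le> sequentially" using G(1) by (rule le_infE)
  then have \<phi>C: "\<phi> \<in> contractions_mod_c0 E"
    by (rule limit_of_coordinates_in_contractions_mod_c0[OF G(2) _ \<phi> lim])
  have "\<forall>\<^sub>F k in G. vnorm E (f k - \<phi> f) < \<epsilon>" if "f \<in> A" for f
    using order_tendstoD(2)[OF lim \<open>0 < \<epsilon>\<close>] that A(2) by blast
  then have "\<forall>\<^sub>F k in G. \<forall>f\<in>A. vnorm E (f k - \<phi> f) < \<epsilon>"
    using A(1) by (simp add: eventually_ball_finite_distrib)
  then have "eventually ?good G" by eventually_elim (use \<phi>C in blast)
  moreover have "\<forall>\<^sub>F k in G. \<not> ?good k"
    using filter_leD[OF G(1)] by (simp add: eventually_inf_principal)
  ultimately have "eventually (\<lambda>_. False) G" by eventually_elim blast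
  then show False using G(2) by (simp add: trivial_limit_def)
qed

end

section \<open>The subspace of null sequences\<close>

context operator_space
begin

lemma subspace_c0: "module.subspace (scal (linf E)) (c0 E)"
proof -
  interpret L: operator_space "linf E" by (rule operator_space_linf) unfold_locales
  show ?thesis
  proof (rule L.subspaceI)
    show "0 \<in> c0 E"
      using L.subspace_0[OF L.subspace_carr] by (simp add: c0_def vnorm_0)
  next
    fix f g assume f: "f \<in> c0 E" and g: "g \<in> c0 E"
    then have c: "f \<in> carr (linf E)" "g \<in> carr (linf E)" by (auto simp: c0_def)
    have "(\<lambda>k. vnorm E ((f + g) k)) \<longlonglongrightarrow> 0"
    proof (rule tendsto_0_squeeze)
      show "(\<lambda>k. vnorm E (f k) + vnorm E (g k)) \<longlonglongrightarrow> 0"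
        using f g tendsto_add[of "\<lambda>k. vnorm E (f k)" 0 _ "\<lambda>k. vnorm E (g k)" 0] by (simp add: c0_def)
      show "vnorm E ((f + g) k) \<le> vnorm E (f k) + vnorm E (g k)" for k
        using vnorm_triangle[OF linf_nth[OF c(1)] linf_nth[OF c(2)]] by simp
      show "0 \<le> vnorm E ((f + g) k)" for k
        by (intro vnorm_nonneg linf_nth[of "f + g"] L.subspace_add[OF L.subspace_carr] c)
    qed
    then show "f + g \<in> c0 E" using c L.subspace_add[OF L.subspace_carr] by (simp add: c0_def)
  next
    fix c f assume f: "f \<in> c0 E"
    then have "vnorm E (scal (linf E) c f k) = cmod c * vnorm E (f k)" for k
      using vnorm_scal[OF linf_nth] by (simp add: c0_def linf_def)
    then show "scal (linf E) c f \<in> c0 E"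
      using f tendsto_mult_right_zero[of "\<lambda>k. vnorm E (f k)" _ "cmod c"]
        L.subspace_scale[OF L.subspace_carr] by (simp add: c0_def)
  qed
qed

lemma c0_limit_closed:
  assumes f: "f \<in> carr (linf E)"
    and approx: "\<And>r. 0 < r \<Longrightarrow> \<exists>g\<in>c0 E. vnorm (linf E) (f - g) < r"
  shows "f \<in> c0 E"
proof -
  interpret L: operator_space "linf E" by (rule operator_space_linf) unfold_locales
  have "(\<lambda>k. vnorm E (f k)) \<longlonglongrightarrow> 0"
  proof (rule tendstoI)
    fix r :: real assume "0 < r"
    then obtain g where g: "g \<in> c0 E" "vnorm (linf E) (f - g) < r / 2"
      using approx[of "r / 2"] by auto
    then have gL: "g \<in> carr (linf E)" by (simp add: c0_def)
    have "(\<lambda>k. vnorm E (g k)) \<longlonglongrightarrow> 0" using g(1) by (simp add: c0_def)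
    then have "\<forall>\<^sub>F k in sequentially. vnorm E (g k) < r / 2"
      using \<open>0 < r\<close> by (intro order_tendstoD) auto
    then show "\<forall>\<^sub>F k in sequentially. dist (vnorm E (f k)) 0 < r"
    proof eventually_elim
      case (elim k)
      have "vnorm E (f k) \<le> vnorm E (g k) + vnorm E ((f - g) k)"
        using vnorm_triangle_diff[OF linf_nth[OF f] linf_nth[OF gL], of k k] by simp
      moreover have "vnorm E ((f - g) k) \<le> vnorm (linf E) (f - g)"
        by (intro vnorm_nth_le L.subspace_diff[OF L.subspace_carr] f gL)
      ultimately show ?case using elim g(2) vnorm_nonneg[OF linf_nth[OF f, of k]] by simp
    qed
  qed
  with f show ?thesis by (simp add: c0_def)
qed

end

lemma closedin_c0:
  assumes "operator_space Z" "operator_space (induced (linf Z) Y)" "c0 Z \<subseteq> Y" "Y \<subseteq> carr (linf Z)"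
  shows "closedin (norm_topology (induced (linf Z) Y)) (c0 Z)"
proof -
  interpret Z: operator_space Z by fact
  interpret M: Metric_space Y "vdist (induced (linf Z) Y)"
    using operator_space.Metric_space_vdist[OF assms(2)] by (simp add: induced_def)
  have top: "norm_topology (induced (linf Z) Y) = M.mtopology"
    by (simp add: norm_topology_def induced_def)
  have dist: "vdist (induced (linf Z) Y) x y = vnorm (linf Z) (x - y)" if "x \<in> Y" "y \<in> Y" for x y
    using that by (simp add: vdist_def vnorm_def induced_def)
  show ?thesis
    unfolding top M.closedin_metric
  proof (intro conjI allI impI assms(3))
    fix f assume f: "f \<in> Y - c0 Z"
    then obtain r where r: "0 < r" "\<And>g. g \<in> c0 Z \<Longrightarrow> \<not> vnorm (linf Z) (f - g) < r"
      using Z.c0_limit_closed[of f] assms(4) by blast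
    have "disjnt (c0 Z) (M.mball f r)"
      using r(2) f assms(3) dist by (auto simp: disjnt_iff M.in_mball)
    with r(1) show "\<exists>r>0. disjnt (c0 Z) (M.mball f r)" by blast
  qed
qed

section \<open>Diagonal approximation of the coordinate maps\<close>

lemma separable_imp_countable_approx:
  assumes Y: "operator_space (induced L Y)" "Y \<subseteq> carr L"
    and sep: "separable_space (norm_topology (induced L Y))"
  obtains D where "countable D" "D \<subseteq> Y"
    "\<And>y r. y \<in> Y \<Longrightarrow> 0 < r \<Longrightarrow> \<exists>d\<in>D. vnorm L (y - d) < r"
proof -
  interpret M: Metric_space Y "vdist (induced L Y)"
    using operator_space.Metric_space_vdist[OF Y(1)] by (simp add: induced_def)
  have top: "norm_topology (induced L Y) = M.mtopology"
    by (simp add: norm_topology_def induced_def)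
  have dist: "vdist (induced L Y) x y = vnorm L (x - y)" if "x \<in> Y" "y \<in> Y" for x y
    using that by (simp add: vdist_def vnorm_def induced_def)
  obtain D where D: "countable D" "D \<subseteq> Y" "M.mtopology closure_of D = Y"
    using sep unfolding separable_space_def top by auto
  have "\<exists>d\<in>D. vnorm L (y - d) < r" if "y \<in> Y" "0 < r" for y r
  proof -
    have "y \<in> M.mtopology closure_of D" using D(3) that(1) by simp
    then show ?thesis
      using that D(2) dist unfolding M.metric_closure_of by (fastforce simp: M.in_mball)
  qed
  with D that show thesis by blast
qed

text \<open>
  At stage \<open>k\<close> the choice serves the most demanding requirement \<open>N \<le> k\<close> that can be met; the bound
  \<open>N \<le> k\<close> guarantees that there is a most demanding one. Every fixed requirement is then met from
  some stage on.
\<close>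

lemma diagonal_choice:
  fixes P :: "nat \<Rightarrow> nat \<Rightarrow> 'b \<Rightarrow> bool"
  assumes ev: "\<And>N. \<forall>\<^sub>F k in sequentially. \<exists>x\<in>S. P N k x" and "S \<noteq> {}"
    and mono: "\<And>M N k x. M \<le> N \<Longrightarrow> P N k x \<Longrightarrow> P M k x"
  shows "\<exists>s. (\<forall>k. s k \<in> S) \<and> (\<forall>N. \<forall>\<^sub>F k in sequentially. P N k (s k))"
proof -
  have "\<exists>x\<in>S. \<forall>N\<le>k. (\<exists>y\<in>S. P N k y) \<longrightarrow> P N k x" for k
  proof (cases "\<exists>N\<le>k. \<exists>y\<in>S. P N k y")
    case True
    let ?N = "GREATEST N. N \<le> k \<and> (\<exists>y\<in>S. P N k y)"
    have "?N \<le> k \<and> (\<exists>y\<in>S. P ?N k y)"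
      using True GreatestI_ex_nat[of "\<lambda>N. N \<le> k \<and> (\<exists>y\<in>S. P N k y)" k] by blast
    then obtain x where x: "x \<in> S" "P ?N k x" by blast
    have "N \<le> ?N" if "N \<le> k" "\<exists>y\<in>S. P N k y" for N
      using that Greatest_le_nat[of "\<lambda>N. N \<le> k \<and> (\<exists>y\<in>S. P N k y)" N k] by blast
    with x mono show ?thesis by blast
  qed (use \<open>S \<noteq> {}\<close> in blast)
  then obtain s where s: "\<And>k. s k \<in> S" "\<And>k N. N \<le> k \<Longrightarrow> \<exists>y\<in>S. P N k y \<Longrightarrow> P N k (s k)" by metis
  have "\<forall>\<^sub>F k in sequentially. P N k (s k)" for N
    using ev[of N] eventually_ge_at_top[of N] by eventually_elim (rule s(2))
  with s(1) show ?thesis by blast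
qed

text \<open>
  The diagonal choice is applied to the requirements "within \<open>1 / (N + 1)\<close> of the \<open>k\<close>-th coordinate on
  the first \<open>N + 1\<close> elements of an enumeration of \<open>D\<close>", which become stronger as \<open>N\<close> grows.
\<close>

lemma contractions_mod_c0_approximating_coordinates:
  assumes Z: "operator_space Z" "finite_dimensional Z"
    and D: "countable D" "D \<subseteq> carr (linf Z)"
  obtains \<phi> where "\<And>k. \<phi> k \<in> contractions_mod_c0 Z"
    "\<And>f. f \<in> D \<Longrightarrow> (\<lambda>k. vnorm Z (f k - \<phi> k f)) \<longlonglongrightarrow> 0"
proof -
  interpret Z: operator_space Z by fact
  interpret L: operator_space "linf Z" by (rule operator_space_linf) fact
  \<comment> \<open>Inserting 0 makes the set nonempty, so that a sequence can enumerate it.\<close>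
  define d where "d = from_nat_into (insert 0 D)"
  have d: "range d = insert 0 D" using D(1) by (simp add: d_def range_from_nat_into)
  then have dL: "d i \<in> carr (linf Z)" for i
    using D(2) L.subspace_0[OF L.subspace_carr] by (metis insertE rangeI subsetD)
  let ?P = "\<lambda>N k \<phi>. \<forall>i\<in>{..N}. vnorm Z (d i k - \<phi> (d i)) < 1 / Suc N"
  have ev: "\<forall>\<^sub>F k in sequentially. \<exists>\<phi>\<in>contractions_mod_c0 Z. ?P N k \<phi>" for N
    using Z.coordinates_near_contractions_mod_c0[OF Z(2), of "d ` {..N}" "1 / Suc N"] dL
    by (simp add: image_subset_iff)
  moreover have "contractions_mod_c0 Z \<noteq> {}"
    using eventually_happens[OF ev[of 0]] by auto
  moreover have "?P M k \<phi>" if "M \<le> N" "?P N k \<phi>" for M N k \<phi>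
  proof
    fix i assume "i \<in> {..M}"
    then have "vnorm Z (d i k - \<phi> (d i)) < 1 / Suc N" using that by simp
    also have "\<dots> \<le> 1 / Suc M" using that(1) by (simp add: frac_le)
    finally show "vnorm Z (d i k - \<phi> (d i)) < 1 / Suc M" .
  qed
  ultimately have "\<exists>\<phi>. (\<forall>k. \<phi> k \<in> contractions_mod_c0 Z) \<and> (\<forall>N. \<forall>\<^sub>F k in sequentially. ?P N k (\<phi> k))"
    by (rule diagonal_choice)
  then obtain \<phi> where \<phi>: "\<And>k. \<phi> k \<in> contractions_mod_c0 Z"
    "\<And>N. \<forall>\<^sub>F k in sequentially. ?P N k (\<phi> k)" by blast
  have "(\<lambda>k. vnorm Z (f k - \<phi> k f)) \<longlonglongrightarrow> 0" if "f \<in> D" for f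
  proof (rule tendstoI)
    fix r :: real assume "0 < r"
    have "f \<in> range d" using d \<open>f \<in> D\<close> by simp
    then obtain i where i: "f = d i" by blast
    obtain m where m: "inverse (Suc m) < r" using reals_Archimedean[OF \<open>0 < r\<close>] by blast
    show "\<forall>\<^sub>F k in sequentially. dist (vnorm Z (f k - \<phi> k f)) 0 < r"
      using \<phi>(2)[of "max i m"]
    proof eventually_elim
      case (elim k)
      have "vnorm Z (f k - \<phi> k f) < 1 / real (Suc (max i m))" using elim i by simp
      also have "\<dots> \<le> inverse (Suc m)" by (simp add: frac_le inverse_eq_divide)
      finally have "vnorm Z (f k - \<phi> k f) < r" using m by simp
      moreover have "\<phi> k f \<in> carr Z"
        using \<phi>(1)[of k] dL[of i] i by (auto simp: contractions_mod_c0_def linear_map_def)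
      then have "0 \<le> vnorm Z (f k - \<phi> k f)"
        using Z.linf_nth[OF dL[of i], of k] i
        by (intro Z.vnorm_nonneg Z.subspace_diff[OF Z.subspace_carr]) auto
      ultimately show ?case by simp
    qed
  qed
  with \<phi>(1) show thesis by (rule that)
qed

section \<open>The projection onto the null sequences\<close>

theorem corollary2p20:
  fixes Z :: "('a::ab_group_add) opspace" and Y :: "(nat \<Rightarrow> 'a) set"
  assumes "operator_space Z"
    and "finite_dimensional Z"
    and "closed_linear_subspace Y (linf Z)"
    and "separable_space (norm_topology (induced (linf Z) Y))"
    and "c0 Z \<subseteq> Y"
  shows "completely_contractively_cocomplemented (c0 Z) (induced (linf Z) Y)"
proof -
  interpret Z: operator_space Z by fact
  interpret L: operator_space "linf Z" by (rule operator_space_linf) fact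
  have Ysub: "L.subspace Y" and YL: "Y \<subseteq> carr (linf Z)"
    using assms(3) by (auto simp: closed_linear_subspace_def)
  have opY: "operator_space (induced (linf Z) Y)" by (rule L.operator_space_induced[OF Ysub YL])
  obtain D where D: "countable D" "D \<subseteq> Y"
    and dense: "\<And>y r. y \<in> Y \<Longrightarrow> 0 < r \<Longrightarrow> \<exists>d\<in>D. vnorm (linf Z) (y - d) < r"
    using separable_imp_countable_approx[OF opY YL assms(4)] by blast
  obtain \<phi> where \<phi>: "\<And>k. \<phi> k \<in> contractions_mod_c0 Z"
    and \<phi>D: "\<And>f. f \<in> D \<Longrightarrow> (\<lambda>k. vnorm Z (f k - \<phi> k f)) \<longlonglongrightarrow> 0"
    using contractions_mod_c0_approximating_coordinates[OF assms(1,2) D(1)] D(2) YL by blast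
  have \<phi>Z: "\<phi> k f \<in> carr Z" if "f \<in> carr (linf Z)" for k f
    using \<phi>[of k] that by (auto simp: contractions_mod_c0_def linear_map_def)
  have \<phi>add: "\<phi> k (f + g) = \<phi> k f + \<phi> k g"
    if "f \<in> carr (linf Z)" "g \<in> carr (linf Z)" for k f g
    using \<phi>[of k] that by (auto simp: contractions_mod_c0_def linear_map_def)
  have \<phi>scal: "\<phi> k (scal (linf Z) c f) = scal Z c (\<phi> k f)" if "f \<in> carr (linf Z)" for k c f
    using \<phi>[of k] that by (auto simp: contractions_mod_c0_def linear_map_def)
  have \<phi>diff: "\<phi> k (f - g) = \<phi> k f - \<phi> k g"
    if "f \<in> carr (linf Z)" "g \<in> carr (linf Z)" for k f g
    using \<phi>add[of "f - g" g k] that L.subspace_diff[OF L.subspace_carr] by (simp add: eq_diff_eq)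
  have \<phi>n: "mnorm Z n (\<lambda>i j. \<phi> k (x i j)) \<le> mnorm (linf Z) n x"
    if "x \<in> mats n (carr (linf Z))" for k n x
    using \<phi>[of k] that by (auto simp: contractions_mod_c0_def)
  have \<phi>v: "vnorm Z (\<phi> k f) \<le> vnorm (linf Z) f" if "f \<in> carr (linf Z)" for k f
    using \<phi>n[of "\<lambda>_ _. f" 1 k] that by (simp add: vnorm_def mats_def)
  have \<phi>0: "\<phi> k f = 0" if "f \<in> c0 Z" for k f
    using \<phi>[of k] that by (auto simp: contractions_mod_c0_def)

  define P where "P y = (\<lambda>k. y k - \<phi> k y)" for y
  \<comment> \<open>An approximation by \<open>d\<close> in the dense set costs the distance twice, once under the \<open>k\<close>-th
    coordinate map and once under \<open>\<phi> k\<close>, both uniformly in \<open>k\<close>.\<close>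
  have tail: "(\<lambda>k. vnorm Z (P y k)) \<longlonglongrightarrow> 0" if y: "y \<in> Y" for y
  proof (rule tendstoI)
    fix r :: real assume "0 < r"
    then obtain d where d: "d \<in> D" "vnorm (linf Z) (y - d) < r / 3"
      using dense[OF y, of "r / 3"] by auto
    have yL: "y \<in> carr (linf Z)" and dL: "d \<in> carr (linf Z)" using y d(1) D(2) YL by auto
    have ydL: "y - d \<in> carr (linf Z)" by (intro L.subspace_diff[OF L.subspace_carr] yL dL)
    have "\<forall>\<^sub>F k in sequentially. vnorm Z (d k - \<phi> k d) < r / 3"
      using \<phi>D[OF d(1)] \<open>0 < r\<close> by (intro order_tendstoD) auto
    then show "\<forall>\<^sub>F k in sequentially. dist (vnorm Z (P y k)) 0 < r"
    proof eventually_elim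
      case (elim k)
      have "vnorm Z (y k - \<phi> k y) \<le> vnorm Z (y k - d k) + vnorm Z (d k - \<phi> k y)"
        by (intro Z.vnorm_triangle3 Z.linf_nth[OF yL] Z.linf_nth[OF dL] \<phi>Z yL dL)
      also have "vnorm Z (d k - \<phi> k y) \<le> vnorm Z (d k - \<phi> k d) + vnorm Z (\<phi> k d - \<phi> k y)"
        by (intro Z.vnorm_triangle3 Z.linf_nth[OF yL] Z.linf_nth[OF dL] \<phi>Z yL dL)
      also have "vnorm Z (\<phi> k d - \<phi> k y) = vnorm Z (\<phi> k (y - d))"
        using Z.vnorm_minus_commute[OF \<phi>Z[OF dL] \<phi>Z[OF yL], of k k] \<phi>diff[OF yL dL, of k] by simp
      also have "\<dots> \<le> vnorm (linf Z) (y - d)" by (rule \<phi>v[OF ydL])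
      also have "vnorm Z (y k - d k) \<le> vnorm (linf Z) (y - d)"
        using Z.vnorm_nth_le[OF ydL, of k] by simp
      finally have "vnorm Z (P y k) < r" using elim d(2) unfolding P_def by linarith
      moreover have "0 \<le> vnorm Z (P y k)"
        unfolding P_def by (intro Z.vnorm_nonneg Z.subspace_diff[OF Z.subspace_carr] Z.linf_nth[OF yL] \<phi>Z yL)
      ultimately show ?case by simp
    qed
  qed
  have lift: "(\<lambda>k. \<phi> k y) \<in> carr (linf Z)" if "y \<in> carr (linf Z)" for y
    using \<phi>Z[OF that] bdd_aboveI2[of UNIV, OF \<phi>v[OF that]] by (simp add: linf_def)
  have Pc0: "P y \<in> c0 Z" if y: "y \<in> Y" for y
  proof -
    have "P y = y - (\<lambda>k. \<phi> k y)" by (simp add: P_def fun_eq_iff)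
    then have "P y \<in> carr (linf Z)"
      using y YL lift L.subspace_diff[OF L.subspace_carr, of y "\<lambda>k. \<phi> k y"] by auto
    then show ?thesis using tail[OF y] by (simp add: c0_def)
  qed
  have Pid: "P y = y" if "y \<in> c0 Z" for y
    using \<phi>0[OF that] by (simp add: P_def)

  have "linear_map (induced (linf Z) Y) (induced (linf Z) Y) P"
  proof -
    have "P (x + y) = P x + P y" if "x \<in> Y" "y \<in> Y" for x y
    proof -
      have "\<phi> k (x + y) = \<phi> k x + \<phi> k y" for k using that YL \<phi>add by blast
      then show ?thesis by (simp add: P_def fun_eq_iff)
    qed
    moreover have "P (scal (linf Z) c x) = scal (linf Z) c (P x)" if "x \<in> Y" for c x
    proof -
      have "\<phi> k (scal (linf Z) c x) = scal Z c (\<phi> k x)" for k using that YL \<phi>scal by auto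
      then show ?thesis by (simp add: P_def linf_def Z.scale_right_diff_distrib)
    qed
    moreover have "P ` Y \<subseteq> Y" using Pc0 assms(5) by blast
    ultimately show ?thesis by (simp add: linear_map_def induced_def)
  qed
  moreover have "P ` Y = c0 Z"
  proof
    show "P ` Y \<subseteq> c0 Z" using Pc0 by blast
    show "c0 Z \<subseteq> P ` Y" using Pid assms(5) by (metis image_eqI subset_eq)
  qed
  moreover have "cb_norm (induced (linf Z) Y) (induced (linf Z) Y) (\<lambda>x. x - P x) \<le> 1"
    unfolding cb_norm_def
  proof (intro SUP_least)
    fix n x
    assume "x \<in> {x \<in> mats n (carr (induced (linf Z) Y)). mnorm (induced (linf Z) Y) n x \<le> 1}"
    then have x: "x \<in> mats n (carr (linf Z))" and x1: "mnorm (linf Z) n x \<le> 1"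
      using YL by (auto simp: mats_def induced_def)
    have "(x i j - P (x i j)) k = \<phi> k (x i j)" for i j k by (simp add: P_def)
    then have "mnorm (linf Z) n (\<lambda>i j. x i j - P (x i j)) = (SUP k. mnorm Z n (\<lambda>i j. \<phi> k (x i j)))"
      by (simp add: linf_def)
    also have "\<dots> \<le> 1"
      using \<phi>n[OF x] x1 by (intro cSUP_least) (auto intro: order_trans)
    finally show "ereal (mnorm (induced (linf Z) Y) n (\<lambda>i j. x i j - P (x i j))) \<le> 1"
      by (simp add: induced_def)
  qed
  moreover have "closed_linear_subspace (c0 Z) (induced (linf Z) Y)"
    using Z.subspace_c0 closedin_c0[OF assms(1) opY assms(5) YL] assms(5)
    by (simp add: closed_linear_subspace_def induced_def)
  moreover have "P (P y) = P y" if "y \<in> Y" for y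
    using Pid[OF Pc0[OF that]] .
  moreover have "carr (induced (linf Z) Y) = Y" by (simp add: induced_def)
  ultimately show ?thesis
    unfolding completely_contractively_cocomplemented_def
    by (intro conjI exI[of _ P]) simp_all
qed

end
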